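(* Let $n,m\ge2$. Let $\psi:\mathcal C_n\to\mathcal C_m$ be a homeomorphism preserving or reversing lexicographic order, let $\phi=\psi^{-1}$, and let $\mathcal A=(Q,\tau,q_0)$ be a full $n$-ary tree-automaton. Put $H=\mathcal D(\mathcal A)\le F_n$. Then the pullback automaton $\mathcal P_\psi(\mathcal A)$ satisfies $$\mathcal D(\mathcal P_\psi(\mathcal A))=H^\psi\cap F_m .$$
   Context: Let $X_n=\{0,\dots,n-1\}$, $\mathcal W_n=X_n^*$ (including the empty word $\varepsilon$), $\mathcal C_n=X_n^{\mathbb N}$ with the lexicographic order, $U_u=u\mathcal C_n$. $F_n$ is the group of order-preserving homeomorphisms $f$ of $\mathcal C_n$ for which there are finite complete prefix codes $\{u_1<\dots<u_k\}$, $\{v_1<\dots<v_k\}$ in $\mathcal W_n$ (complete: their cylinders partition $\mathcal C_n$) with $f(u_i\omega)=v_i\omega$. Such a pair of codes is a tree diagram of $f$ with branch pairs $u_i\to v_i$. $H^\psi=\{\omega\mapsto\psi(h(\psi^{-1}(\omega))):h\in H\}$. An $n$-ary tree-automaton is $\mathcal A=(Q,\tau,q_0)$ with state set $Q$ (possibly infinite), root $q_0$, and partial transition function $\tau:Q\times X_n\dashrightarrow Q$, extended to words in the usual way, such that every state is $\tau(q_0,u)$ for some word $u$ and each state has either no outgoing transitions or a transition for every letter of $X_n$. It is full if every state has all $n$ transitions. A tree diagram with branch pairs $u_i\to v_i$ is accepted by $\mathcal A$ if $\tau(q_0,u_i)$ and $\tau(q_0,v_i)$ are all defined and $\tau(q_0,u_i)=\tau(q_0,v_i)$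 for every $i$. $\mathcal D(\mathcal A)$ is the subgroup of $F_n$ of elements admitting at least one accepted tree diagram. For a continuous injective $f:\mathcal C_m\to\mathcal C_n$ and $x\in\mathcal W_m$, let $\theta_f(x)$ be the greatest common prefix of $f(U_x)$, and let the local action $f_x:\mathcal C_m\to\mathcal C_n$ be defined by $f(x\omega)=\theta_f(x)f_x(\omega)$. The minimal transducer of $\phi$ is $T^\phi=(S_\phi,t_\phi,o_\phi,s_\phi)$ with $S_\phi=\{\phi_x:x\in\mathcal W_m\}$, $s_\phi=\phi$, $t_\phi(f,a)=f_a$, and $o_\phi(f,a)=\theta_f(a)$ for $a\in X_m$. The pullback automaton $\mathcal P_\psi(\mathcal A)$ is the part reachable from the root of the full $m$-ary automaton with state set $S_\phi\times Q$, root $(s_\phi,q_0)$, and transitions $(s,q)\cdot a=\bigl(t_\phi(s,a),\tau(q,o_\phi(s,a))\bigr)$ for $a\in X_m$. Equivalently, $x\in\mathcal W_m$ leads from the root to $(\phi_x,\tau(q_0,\theta_\phi(x)))$. *)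

theory Defs
  imports
    "HOL-Analysis.Analysis"
    "HOL-Library.Fun_Lexorder"
    "HOL-Library.Omega_Words_Fun"
    "HOL-Library.Sublist"
begin

text \<open>
  Infinite words are functions on the naturals. The topology is the library's product topology
  on functions with discrete factors, and the lexicographic order is \<^const>\<open>less_fun\<close>.
  A map on \<open>cantor n\<close> is represented by its \<^const>\<open>extensional\<close> representative, so that
  equality of HOL functions is equality of maps on \<open>cantor n\<close>.
\<close>

definition words :: "nat \<Rightarrow> nat list set" where
  "words n = lists {..<n}"

definition cantor :: "nat \<Rightarrow> (nat \<Rightarrow> nat) set" where
  "cantor n = {\<omega>. \<forall>i. \<omega> i < n}"

definition cylinder :: "nat \<Rightarrow> nat list \<Rightarrow> (nat \<Rightarrow> nat) set" where
  "cylinder n u = (\<lambda>\<omega>. u \<frown> \<omega>) ` cantor n"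


section \<open>Tree diagrams and the group F\<close>

definition complete_prefix_code :: "nat \<Rightarrow> nat list set \<Rightarrow> bool" where
  "complete_prefix_code n U \<longleftrightarrow>
     finite U \<and> U \<subseteq> words n \<and>
     (\<forall>u\<in>U. \<forall>v\<in>U. Sublist.prefix u v \<longrightarrow> u = v) \<and>
     partition_on (cantor n) (cylinder n ` U)"

text \<open>The two codes are given as lists in increasing lexicographic order.\<close>

definition tree_diagram ::
    "nat \<Rightarrow> ((nat \<Rightarrow> nat) \<Rightarrow> nat \<Rightarrow> nat) \<Rightarrow> nat list list \<Rightarrow> nat list list \<Rightarrow> bool" where
  "tree_diagram n f us vs \<longleftrightarrow>
     complete_prefix_code n (set us) \<and> complete_prefix_code n (set vs) \<and>
     sorted_wrt (\<lambda>u v. (u, v) \<in> lexord less_than) us \<and>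
     sorted_wrt (\<lambda>u v. (u, v) \<in> lexord less_than) vs \<and>
     length us = length vs \<and>
     (\<forall>i<length us. \<forall>\<omega>\<in>cantor n. f (us ! i \<frown> \<omega>) = vs ! i \<frown> \<omega>)"

definition thompson_F :: "nat \<Rightarrow> ((nat \<Rightarrow> nat) \<Rightarrow> nat \<Rightarrow> nat) set" where
  "thompson_F n = {f \<in> extensional (cantor n).
     (\<exists>g. homeomorphism (cantor n) (cantor n) f g) \<and>
     monotone_on (cantor n) less_fun less_fun f \<and>
     (\<exists>us vs. tree_diagram n f us vs)}"

text \<open>\<open>conjugate m \<psi> \<phi> H\<close> is $H^\psi$, where \<open>\<phi>\<close> is the inverse of \<open>\<psi>\<close>
  and \<open>cantor m\<close> is the codomain of \<open>\<psi>\<close>.\<close>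

definition conjugate ::
    "nat \<Rightarrow> ((nat \<Rightarrow> nat) \<Rightarrow> nat \<Rightarrow> nat) \<Rightarrow> ((nat \<Rightarrow> nat) \<Rightarrow> nat \<Rightarrow> nat) \<Rightarrow>
     ((nat \<Rightarrow> nat) \<Rightarrow> nat \<Rightarrow> nat) set \<Rightarrow> ((nat \<Rightarrow> nat) \<Rightarrow> nat \<Rightarrow> nat) set" where
  "conjugate m \<psi> \<phi> H = (\<lambda>h. \<lambda>\<omega>\<in>cantor m. \<psi> (h (\<phi> \<omega>))) ` H"


section \<open>Tree-automata\<close>

record 'q automaton =
  states :: "'q set"
  trans :: "'q \<times> nat \<rightharpoonup> 'q"
  root :: 'q

fun run :: "('q, 'z) automaton_scheme \<Rightarrow> 'q \<Rightarrow> nat list \<rightharpoonup> 'q" where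
  "run A q [] = Some q"
| "run A q (a # u) = Option.bind (trans A (q, a)) (\<lambda>q'. run A q' u)"

locale tree_automaton =
  fixes n :: nat and A :: "'q automaton"
  assumes root_in_states: "root A \<in> states A"
    and dom_trans: "dom (trans A) \<subseteq> states A \<times> {..<n}"
    and ran_trans: "ran (trans A) \<subseteq> states A"
    and reachable: "q \<in> states A \<Longrightarrow> \<exists>u\<in>words n. run A (root A) u = Some q"
    and none_or_all: "q \<in> states A \<Longrightarrow>
      (\<forall>a<n. trans A (q, a) = None) \<or> (\<forall>a<n. trans A (q, a) \<noteq> None)"

locale full_tree_automaton = tree_automaton +
  assumes full: "q \<in> states A \<Longrightarrow> a < n \<Longrightarrow> trans A (q, a) \<noteq> None"

definition accepted :: "'q automaton \<Rightarrow> nat list list \<Rightarrow> nat list list \<Rightarrow> bool" where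
  "accepted A us vs \<longleftrightarrow>
     (\<forall>i<length us. \<exists>q. run A (root A) (us ! i) = Some q \<and> run A (root A) (vs ! i) = Some q)"

definition diagram_group :: "nat \<Rightarrow> 'q automaton \<Rightarrow> ((nat \<Rightarrow> nat) \<Rightarrow> nat \<Rightarrow> nat) set" where
  "diagram_group n A =
     {f \<in> thompson_F n. \<exists>us vs. tree_diagram n f us vs \<and> accepted A us vs}"


section \<open>Local actions and the minimal transducer\<close>

text \<open>The greatest common prefix of the image of a cylinder. It exists (and is then unique) for
  injective maps on \<open>cantor m\<close> with \<open>2 \<le> m\<close>.\<close>

definition theta :: "nat \<Rightarrow> ((nat \<Rightarrow> nat) \<Rightarrow> nat \<Rightarrow> nat) \<Rightarrow> nat list \<Rightarrow> nat list" where
  "theta m f x = (ARG_MAX length u. \<forall>\<omega> \<in> f ` cylinder m x. \<omega> \<in> range (\<lambda>\<zeta>. u \<frown> \<zeta>))"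

definition local_action ::
    "nat \<Rightarrow> ((nat \<Rightarrow> nat) \<Rightarrow> nat \<Rightarrow> nat) \<Rightarrow> nat list \<Rightarrow> (nat \<Rightarrow> nat) \<Rightarrow> nat \<Rightarrow> nat" where
  "local_action m f x =
     (\<lambda>\<omega>\<in>cantor m. Omega_Words_Fun.suffix (length (theta m f x)) (f (x \<frown> \<omega>)))"

lemma conc_in_cantor: "x \<in> words m \<Longrightarrow> \<omega> \<in> cantor m \<Longrightarrow> x \<frown> \<omega> \<in> cantor m"
  by (auto simp: cantor_def words_def conc_def in_lists_conv_set)

lemma common_prefix_theta:
  assumes "2 \<le> m" "inj_on f (cantor m)" "x \<in> words m"
  shows "\<forall>\<omega> \<in> f ` cylinder m x. \<omega> \<in> range (\<lambda>\<zeta>. theta m f x \<frown> \<zeta>)"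
    and "(\<forall>\<omega> \<in> f ` cylinder m x. \<omega> \<in> range (\<lambda>\<zeta>. u \<frown> \<zeta>)) \<Longrightarrow> length u \<le> length (theta m f x)"
proof -
  let ?P = "\<lambda>u. \<forall>\<omega> \<in> f ` cylinder m x. \<omega> \<in> range (\<lambda>\<zeta>. u \<frown> \<zeta>)"
  define v w where "v = x \<frown> (\<lambda>_. 0::nat)" and "w = x \<frown> (\<lambda>_. 1::nat)"
  have vw: "v \<in> cylinder m x" "w \<in> cylinder m x"
    using assms(1) by (auto simp: v_def w_def cylinder_def cantor_def)
  have "v (length x) \<noteq> w (length x)" by (simp add: v_def w_def conc_def)
  hence "v \<noteq> w" by auto
  moreover have "v \<in> cantor m" "w \<in> cantor m"
    unfolding v_def w_def
    by (rule conc_in_cantor[OF assms(3)], use assms(1) in \<open>simp add: cantor_def\<close>)+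
  ultimately have "f v \<noteq> f w" using assms(2) by (auto dest: inj_onD)
  then obtain k where k: "f v k \<noteq> f w k" by auto
  have bound: "length u < Suc k" if "?P u" for u
  proof (rule ccontr)
    assume "\<not> length u < Suc k"
    moreover obtain a b where "f v = u \<frown> a" "f w = u \<frown> b" using \<open>?P u\<close> vw by blast
    ultimately show False using k by (simp add: conc_def)
  qed
  have "?P []" by (simp add: conc_def)
  have *: "?P (theta m f x) \<and> (\<forall>u. ?P u \<longrightarrow> length u \<le> length (theta m f x))"
    unfolding theta_def by (rule arg_max_nat_lemma[where P = ?P, OF \<open>?P []\<close>]) (use bound in blast)
  show "?P (theta m f x)" and "?P u \<Longrightarrow> length u \<le> length (theta m f x)"
    using * by blast+
qed

lemma local_action_eq:
  assumes "2 \<le> m" "inj_on f (cantor m)" "x \<in> words m" "\<omega> \<in> cantor m"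
  shows "f (x \<frown> \<omega>) = theta m f x \<frown> local_action m f x \<omega>"
proof -
  have "f (x \<frown> \<omega>) \<in> f ` cylinder m x" using assms(4) by (auto simp: cylinder_def)
  then obtain \<zeta> where "f (x \<frown> \<omega>) = theta m f x \<frown> \<zeta>"
    using common_prefix_theta(1)[OF assms(1-3)] by blast
  thus ?thesis using assms(4) by (simp add: local_action_def)
qed

record 's transducer =
  tstates :: "'s set"
  tstep :: "'s \<Rightarrow> nat \<Rightarrow> 's"
  tout :: "'s \<Rightarrow> nat \<Rightarrow> nat list"
  tinit :: 's

definition minimal_transducer ::
    "nat \<Rightarrow> ((nat \<Rightarrow> nat) \<Rightarrow> nat \<Rightarrow> nat) \<Rightarrow> ((nat \<Rightarrow> nat) \<Rightarrow> nat \<Rightarrow> nat) transducer" where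
  "minimal_transducer m \<phi> =
     \<lparr>tstates = local_action m \<phi> ` words m,
      tstep = (\<lambda>f a. local_action m f [a]),
      tout = (\<lambda>f a. theta m f [a]),
      tinit = restrict \<phi> (cantor m)\<rparr>"


section \<open>The pullback automaton\<close>

definition product_automaton ::
    "nat \<Rightarrow> 's transducer \<Rightarrow> 'q automaton \<Rightarrow> ('s \<times> 'q) automaton" where
  "product_automaton m T A =
     \<lparr>states = tstates T \<times> states A,
      trans = (\<lambda>((s, q), a).
        if s \<in> tstates T \<and> q \<in> states A \<and> a < m
        then map_option (\<lambda>q'. (tstep T s a, q')) (run A q (tout T s a))
        else None),
      root = (tinit T, root A)\<rparr>"

definition reachable_part :: "nat \<Rightarrow> 'q automaton \<Rightarrow> 'q automaton" where
  "reachable_part m B =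
     (let R = {p. \<exists>x\<in>words m. run B (root B) x = Some p}
      in \<lparr>states = R, trans = trans B |` (R \<times> {..<m}), root = root B\<rparr>)"

text \<open>The second argument is $\phi = \psi^{-1}$, a map from \<open>cantor m\<close> to the Cantor space over
  the alphabet of \<open>A\<close>.\<close>

definition pullback_automaton ::
    "nat \<Rightarrow> ((nat \<Rightarrow> nat) \<Rightarrow> nat \<Rightarrow> nat) \<Rightarrow> 'q automaton \<Rightarrow>
     (((nat \<Rightarrow> nat) \<Rightarrow> nat \<Rightarrow> nat) \<times> 'q) automaton" where
  "pullback_automaton m \<phi> A =
     reachable_part m (product_automaton m (minimal_transducer m \<phi>) A)"

end

theory Submission
  imports Defs "HOL-Library.List_Lexorder"
begin

text \<open>
  A word \<open>x\<close> leads in the pullback automaton to the pair of the local action $\phi_x$ and the state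
  $\tau(q_0, \theta_\phi(x))$. If $f$ maps $x\omega$ to $y\omega$ and $x$, $y$ lead to the same pair,
  then $\phi f \phi^{-1}$ acts on $\phi(U_x)$ as the prefix replacement
  $\theta_\phi(x) \to \theta_\phi(y)$ between words with the same state. Conversely, if
  $\phi f \phi^{-1}$ acts on a cylinder $U_u \supseteq \phi(U_x)$ as $u \to v$, then
  $\theta_\phi(x) = uw$, and comparing $\phi(y\omega)$ with $v w \phi_x(\omega)$ gives
  $\theta_\phi(y) = vw$ and $\phi_y = \phi_x$. By compactness, such cylinders can always be found
  after refining a code to all words of one sufficiently large length.
\<close>

section \<open>Words and cylinders\<close>

lemma in_words_iff: "u \<in> words n \<longleftrightarrow> (\<forall>i<length u. u ! i < n)"
  by (fastforce simp: words_def in_lists_conv_set in_set_conv_nth)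

lemma append_in_words [simp]: "u @ v \<in> words n \<longleftrightarrow> u \<in> words n \<and> v \<in> words n"
  by (simp add: words_def)

lemma conc_in_cantor_iff: "u \<frown> \<omega> \<in> cantor n \<longleftrightarrow> u \<in> words n \<and> \<omega> \<in> cantor n"
proof
  assume *: "u \<frown> \<omega> \<in> cantor n"
  have "u ! i < n" if "i < length u" for i
    using * that conc_fst[of i u \<omega>] unfolding cantor_def by (metis mem_Collect_eq)
  moreover have "\<omega> i < n" for i
    using * conc_snd[of "length u + i" u \<omega>] unfolding cantor_def
    by (metis add_diff_cancel_left' mem_Collect_eq not_add_less1)
  ultimately show "u \<in> words n \<and> \<omega> \<in> cantor n"
    by (auto simp: in_words_iff cantor_def)
qed (use conc_in_cantor in blast)

lemma conc_inject [simp]: "u \<frown> \<omega> = u \<frown> \<zeta> \<longleftrightarrow> \<omega> = \<zeta>"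
proof
  assume *: "u \<frown> \<omega> = u \<frown> \<zeta>"
  show "\<omega> = \<zeta>"
  proof
    show "\<omega> i = \<zeta> i" for i
      using fun_cong[OF *, of "length u + i"] by simp
  qed
qed simp

lemma conc_eq_concE:
  assumes "u \<frown> \<omega> = v \<frown> \<zeta>" "length u \<le> length v"
  obtains w where "v = u @ w" "\<omega> = w \<frown> \<zeta>"
proof -
  have "v ! i = u ! i" if "i < length u" for i
    using fun_cong[OF assms(1), of i] that assms(2) by simp
  then have "take (length u) v = u"
    using assms(2) by (auto simp: list_eq_iff_nth_eq)
  then obtain w where v: "v = u @ w"
    by (metis append_take_drop_id)
  then have "u \<frown> \<omega> = u \<frown> (w \<frown> \<zeta>)"
    using assms(1) by simp
  then have "\<omega> = w \<frown> \<zeta>"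
    by (simp only: conc_inject)
  with v that show thesis by blast
qed

lemma conc_prefix_cases:
  assumes "u \<frown> \<omega> = v \<frown> \<zeta>"
  shows "Sublist.prefix u v \<or> Sublist.prefix v u"
  using conc_eq_concE[OF assms] conc_eq_concE[OF assms[symmetric]]
  by (metis linear prefixI)

lemma in_cylinder_iff: "\<omega> \<in> cylinder n u \<longleftrightarrow> (\<exists>\<zeta>\<in>cantor n. \<omega> = u \<frown> \<zeta>)"
  by (auto simp: cylinder_def)

lemma cylinder_subset: "u \<in> words n \<Longrightarrow> cylinder n u \<subseteq> cantor n"
  by (auto simp: in_cylinder_iff conc_in_cantor)

lemma in_cylinder_iff_nth:
  "\<omega> \<in> cantor n \<Longrightarrow> \<omega> \<in> cylinder n u \<longleftrightarrow> (\<forall>i<length u. \<omega> i = u ! i)"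
proof
  assume \<omega>: "\<omega> \<in> cantor n" and *: "\<forall>i<length u. \<omega> i = u ! i"
  have "\<omega> = u \<frown> Omega_Words_Fun.suffix (length u) \<omega>"
    using * by (auto simp: conc_def fun_eq_iff)
  moreover have "Omega_Words_Fun.suffix (length u) \<omega> \<in> cantor n"
    using \<omega> by (simp add: cantor_def)
  ultimately show "\<omega> \<in> cylinder n u" by (auto simp: in_cylinder_iff)
qed (auto simp: in_cylinder_iff)

lemma const_in_cantor: "a < n \<Longrightarrow> (\<lambda>_. a) \<in> cantor n"
  by (simp add: cantor_def)

text \<open>If \<open>u\<close> were longer than \<open>v\<close>, the tails \<open>000...\<close>
  and \<open>111...\<close> after \<open>v\<close> would force the letter of \<open>u\<close> at
  position \<open>length v\<close> to be both 0 and 1; this is where two letters are needed.\<close>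

lemma cylinder_subset_imp_prefix:
  assumes "2 \<le> n" "cylinder n v \<subseteq> cylinder n u"
  obtains w where "v = u @ w"
proof -
  have "\<exists>\<zeta>. v \<frown> (\<lambda>_. a) = u \<frown> \<zeta>" if "a < n" for a
  proof -
    have "v \<frown> (\<lambda>_. a) \<in> cylinder n v"
      using const_in_cantor[OF that] by (auto simp: in_cylinder_iff)
    with assms(2) have "v \<frown> (\<lambda>_. a) \<in> cylinder n u" by blast
    then show ?thesis by (auto simp: in_cylinder_iff)
  qed
  from this[of 0] this[of 1] assms(1) obtain \<zeta>0 \<zeta>1
    where \<zeta>: "v \<frown> (\<lambda>_. 0) = u \<frown> \<zeta>0" "v \<frown> (\<lambda>_. 1) = u \<frown> \<zeta>1" by auto
  have "length u \<le> length v"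
  proof (rule ccontr)
    assume "\<not> length u \<le> length v"
    then show False
      using fun_cong[OF \<zeta>(1), of "length v"] fun_cong[OF \<zeta>(2), of "length v"] by simp
  qed
  with conc_eq_concE[OF \<zeta>(1)[symmetric]] that show thesis by metis
qed

text \<open>Words whose cylinders share a point are comparable in the prefix order, so
  prefix-freeness leaves one code word per point. Conversely \<open>0 < n\<close> puts a point into
  every cylinder, and a code word extending another would share that point with it.\<close>

lemma complete_prefix_code_iff:
  assumes "0 < n"
  shows "complete_prefix_code n U \<longleftrightarrow>
    finite U \<and> U \<subseteq> words n \<and> (\<forall>\<omega>\<in>cantor n. \<exists>!u. u \<in> U \<and> \<omega> \<in> cylinder n u)"
    (is "?L \<longleftrightarrow> ?R")
proof
  assume L: ?L
  then have cover: "(\<Union>u\<in>U. cylinder n u) = cantor n"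
    by (simp add: complete_prefix_code_def partition_on_def)
  have "u = v" if "u \<in> U" "v \<in> U" "\<omega> \<in> cylinder n u" "\<omega> \<in> cylinder n v" for u v \<omega>
  proof -
    have "Sublist.prefix u v \<or> Sublist.prefix v u"
      using that by (auto simp: in_cylinder_iff dest: conc_prefix_cases)
    then show ?thesis using L that by (auto simp: complete_prefix_code_def)
  qed
  with cover L show ?R unfolding complete_prefix_code_def by blast
next
  assume R: ?R
  have pt: "u \<frown> (\<lambda>_. 0) \<in> cylinder n u" for u
    using const_in_cantor[OF assms] by (auto simp: in_cylinder_iff)
  have uniq: "u = v" if "u \<in> U" "v \<in> U" "\<omega> \<in> cylinder n u" "\<omega> \<in> cylinder n v" for u v \<omega>
    using R that cylinder_subset[of u n] by blast
  have "u = v" if "u \<in> U" "v \<in> U" "Sublist.prefix u v" for u v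
  proof (rule uniq[OF that(1,2) _ pt])
    from that(2,3) R obtain w where w: "v = u @ w" "w \<in> words n" by (auto elim!: prefixE)
    then have "w \<frown> (\<lambda>_. 0) \<in> cantor n"
      using conc_in_cantor[OF _ const_in_cantor[OF assms]] by blast
    moreover have "v \<frown> (\<lambda>_. 0) = u \<frown> w \<frown> (\<lambda>_. 0)" using w by simp
    ultimately show "v \<frown> (\<lambda>_. 0) \<in> cylinder n u" unfolding in_cylinder_iff by blast
  qed
  moreover have "partition_on (cantor n) (cylinder n ` U)"
  proof (rule partition_onI)
    show "\<Union> (cylinder n ` U) = cantor n" using R cylinder_subset by blast
    show "{} \<notin> cylinder n ` U" using pt by blast
    show "disjnt p q" if "p \<in> cylinder n ` U" "q \<in> cylinder n ` U" "p \<noteq> q" for p q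
      using that uniq by (auto simp: disjnt_def)
  qed
  ultimately show ?L using R by (auto simp: complete_prefix_code_def)
qed

lemma complete_prefix_code_unique:
  assumes "0 < n" "complete_prefix_code n U" "u \<in> U" "v \<in> U"
    and "\<omega> \<in> cylinder n u" "\<omega> \<in> cylinder n v"
  shows "u = v"
  using assms cylinder_subset[of u n] unfolding complete_prefix_code_iff[OF assms(1)] by blast

lemma complete_prefix_code_length:
  assumes "0 < n"
  shows "complete_prefix_code n {u \<in> words n. length u = k}"
  unfolding complete_prefix_code_iff[OF assms]
proof (intro conjI ballI)
  have "{u \<in> words n. length u = k} = {u. set u \<subseteq> {..<n} \<and> length u = k}"
    by (auto simp: words_def)
  then show "finite {u \<in> words n. length u = k}"
    by (simp add: finite_lists_length_eq)
  fix \<omega> assume \<omega>: "\<omega> \<in> cantor n"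
  show "\<exists>!u. u \<in> {u \<in> words n. length u = k} \<and> \<omega> \<in> cylinder n u"
  proof (rule ex1I[of _ "map \<omega> [0..<k]"])
    show "map \<omega> [0..<k] \<in> {u \<in> words n. length u = k} \<and> \<omega> \<in> cylinder n (map \<omega> [0..<k])"
      using \<omega> by (simp add: in_cylinder_iff_nth in_words_iff) (simp add: cantor_def)
  qed (use \<omega> in \<open>auto simp: in_cylinder_iff_nth intro: nth_equalityI\<close>)
qed auto


section \<open>Uniform refinement\<close>

text \<open>Tychonoff for finite discrete factors.\<close>

lemma compact_cantor: "compact (cantor n)"
proof -
  have "cantor n = PiE UNIV (\<lambda>_. {..<n})" by (auto simp: cantor_def)
  then have "compactin (product_topology (\<lambda>_. euclidean) UNIV) (cantor n)"
    by (simp add: compactin_PiE finite_imp_compact)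
  then show ?thesis by (simp add: euclidean_product_topology)
qed

lemma open_agree: "open {\<omega>::nat \<Rightarrow> nat. \<forall>i<k. \<omega> i = \<zeta> i}"
  using product_topology_basis'[of "{..<k}" "\<lambda>i. {\<zeta> i}" "\<lambda>i. i"] by (simp add: open_discrete Ball_def)

text \<open>A basic open set of the product constrains finitely many coordinates only;
  \<open>k\<close> bounds them all.\<close>

lemma open_agree_subset:
  assumes "open S" "(\<zeta>::nat \<Rightarrow> nat) \<in> S"
  obtains k where "{\<omega>. \<forall>i<k. \<omega> i = \<zeta> i} \<subseteq> S"
proof -
  have "openin (product_topology (\<lambda>_. euclidean) UNIV) S"
    using assms(1) by (simp only: open_fun_def)
  from product_topology_open_contains_basis[OF this assms(2)] obtain X
    where X: "\<zeta> \<in> PiE UNIV X" "finite {i. X i \<noteq> UNIV}" "PiE UNIV X \<subseteq> S"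
    by (elim exE conjE) (simp only: topspace_euclidean)
  from finite_nat_bounded[OF X(2)] obtain k where k: "{i. X i \<noteq> UNIV} \<subseteq> {..<k}" ..
  have "\<omega> \<in> PiE UNIV X" if "\<forall>i<k. \<omega> i = \<zeta> i" for \<omega>
  proof (rule PiE_I)
    show "\<omega> i \<in> X i" for i
    proof (cases "i < k")
      case True
      with that show ?thesis using PiE_mem[OF X(1) UNIV_I, of i] by simp
    next
      case False
      with k have "X i = UNIV" by blast
      then show ?thesis by simp
    qed
  qed simp
  then have "{\<omega>. \<forall>i<k. \<omega> i = \<zeta> i} \<subseteq> S"
    using X(3) by blast
  then show thesis by (rule that)
qed

text \<open>A Lebesgue number argument: near each point, finitely many letters decide the code
  cylinder of the image by continuity, and compactness makes the number of letters uniform. It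
  serves to cut a tree diagram along words of one length.\<close>

lemma uniform_refinement:
  assumes "0 < m" "continuous_on (cantor n) f" "f ` cantor n \<subseteq> cantor m"
    and "complete_prefix_code m X"
  obtains K where "\<And>w. w \<in> words n \<Longrightarrow> K \<le> length w \<Longrightarrow> \<exists>x\<in>X. f ` cylinder n w \<subseteq> cylinder m x"
proof -
  have "\<exists>k. \<exists>x\<in>X. \<forall>\<omega>\<in>cantor n. (\<forall>i<k. \<omega> i = \<zeta> i) \<longrightarrow> f \<omega> \<in> cylinder m x"
    if \<zeta>: "\<zeta> \<in> cantor n" for \<zeta>
  proof -
    have f\<zeta>: "f \<zeta> \<in> cantor m" using \<zeta> assms(3) by blast
    with assms(4) obtain x where x: "x \<in> X" "f \<zeta> \<in> cylinder m x"
      unfolding complete_prefix_code_iff[OF assms(1)] by blast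
    \<comment> \<open>Within \<open>cantor m\<close> this open set is exactly the cylinder of
      \<open>x\<close>, so continuity applies to its preimage.\<close>
    let ?V = "{\<omega>. \<forall>i<length x. \<omega> i = x ! i}"
    obtain T where T: "open T" "T \<inter> cantor n = f -` ?V \<inter> cantor n"
      using continuous_on_open_invariant[THEN iffD1, rule_format, OF assms(2) open_agree] by metis
    have "\<zeta> \<in> T" using T(2) x(2) \<zeta> f\<zeta> by (auto simp: in_cylinder_iff_nth)
    then obtain k where k: "{\<omega>. \<forall>i<k. \<omega> i = \<zeta> i} \<subseteq> T"
      using open_agree_subset[OF T(1)] by blast
    have "f \<omega> \<in> cylinder m x" if "\<omega> \<in> cantor n" "\<forall>i<k. \<omega> i = \<zeta> i" for \<omega>
    proof -
      have "\<omega> \<in> T \<inter> cantor n" using k that by blast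
      then have "f \<omega> \<in> ?V" using T(2) by auto
      moreover have "f \<omega> \<in> cantor m" using that(1) assms(3) by blast
      ultimately show ?thesis by (simp add: in_cylinder_iff_nth)
    qed
    with x(1) show ?thesis by blast
  qed
  then have "\<forall>\<zeta>\<in>cantor n. \<exists>k. \<exists>x\<in>X. \<forall>\<omega>\<in>cantor n. (\<forall>i<k. \<omega> i = \<zeta> i) \<longrightarrow> f \<omega> \<in> cylinder m x"
    by (rule ballI)
  from bchoice[OF this] obtain k where k: "\<And>\<zeta>. \<zeta> \<in> cantor n \<Longrightarrow>
      \<exists>x\<in>X. \<forall>\<omega>\<in>cantor n. (\<forall>i<k \<zeta>. \<omega> i = \<zeta> i) \<longrightarrow> f \<omega> \<in> cylinder m x"
    by blast
  let ?N = "\<lambda>\<zeta>. {\<omega>. \<forall>i<k \<zeta>. \<omega> i = \<zeta> i}"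
  obtain D where D: "D \<subseteq> cantor n" "finite D" "cantor n \<subseteq> (\<Union>\<zeta>\<in>D. ?N \<zeta>)"
    by (rule compactE_image[OF compact_cantor, of "cantor n" ?N]) (auto intro: open_agree)
  \<comment> \<open>The inserted 0 keeps \<open>Max\<close> meaningful when \<open>D\<close> is
    empty, as may happen for \<open>n = 0\<close>.\<close>
  define K where "K = Max (insert 0 (k ` D))"
  have K: "k \<zeta> \<le> K" if "\<zeta> \<in> D" for \<zeta> unfolding K_def using that D(2) by (intro Max_ge) auto
  show thesis
  proof (rule that[of K])
    fix w assume w: "w \<in> words n" "K \<le> length w"
    show "\<exists>x\<in>X. f ` cylinder n w \<subseteq> cylinder m x"
    proof (cases "n = 0")
      case True
      then have "cylinder n w = {}" by (simp add: cylinder_def cantor_def)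
      moreover have "X \<noteq> {}"
        using assms(4) const_in_cantor[OF assms(1)]
        unfolding complete_prefix_code_iff[OF assms(1)] by blast
      ultimately show ?thesis by auto
    next
      case False
      \<comment> \<open>Any point of the cylinder of \<open>w\<close> would do. Since
        \<open>k \<zeta> \<le> K \<le> length w\<close>, agreement with \<open>\<zeta>\<close>
        depends on \<open>w\<close> alone and so passes to the whole cylinder.\<close>
      then have "w \<frown> (\<lambda>_. 0) \<in> cantor n" by (simp add: conc_in_cantor w(1) const_in_cantor)
      with D(3) obtain \<zeta> where \<zeta>: "\<zeta> \<in> D" "\<forall>i<k \<zeta>. (w \<frown> (\<lambda>_. 0)) i = \<zeta> i" by blast
      have w\<zeta>: "w ! i = \<zeta> i" if "i < k \<zeta>" for i
        using \<zeta> that K[OF \<zeta>(1)] w(2) by auto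
      obtain x where x: "x \<in> X"
        "\<forall>\<omega>\<in>cantor n. (\<forall>i<k \<zeta>. \<omega> i = \<zeta> i) \<longrightarrow> f \<omega> \<in> cylinder m x"
        using k \<zeta>(1) D(1) by blast
      have "f (w \<frown> \<omega>) \<in> cylinder m x" if "\<omega> \<in> cantor n" for \<omega>
        using x(2) conc_in_cantor[OF w(1) that] w\<zeta> K[OF \<zeta>(1)] w(2) by auto
      then have "f ` cylinder n w \<subseteq> cylinder m x" by (auto simp: cylinder_def)
      with x(1) show ?thesis by blast
    qed
  qed
qed


section \<open>Monotone maps and tree diagrams\<close>

text \<open>Identifies the relation inside \<open>list_less_def\<close> with the one in
  \<open>tree_diagram\<close>, so that sorted lists of words can be used.\<close>

lemma less_than_eq: "less_than = {(u, v). u < v}"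
  by auto

lemma less_fun_total:
  fixes f g :: "nat \<Rightarrow> nat"
  assumes "f \<noteq> g"
  shows "less_fun f g \<or> less_fun g f"
proof -
  from assms have ex: "\<exists>k. f k \<noteq> g k" by auto
  define k where "k = (LEAST k. f k \<noteq> g k)"
  have "f k \<noteq> g k" unfolding k_def by (rule LeastI_ex[OF ex])
  moreover have "f i = g i" if "i < k" for i
    using not_less_Least[OF that[unfolded k_def]] by simp
  ultimately show ?thesis
    unfolding less_fun_def by (metis linorder_neq_iff)
qed

text \<open>Once the prefix case is excluded, the words differ at a first letter, which decides the
  order whatever the tails are.\<close>

lemma lexord_imp_less_fun:
  assumes "(u, v) \<in> lexord less_than" "\<not> Sublist.prefix u v"
  shows "less_fun (u \<frown> \<omega>) (v \<frown> \<zeta>)"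
proof -
  from assms obtain p a b s t where u: "u = p @ a # s" and v: "v = p @ b # t" and ab: "a < b"
    unfolding lexord_def by (auto simp: prefix_def)
  show ?thesis
  proof (rule less_funI, intro exI conjI allI impI)
    show "(u \<frown> \<omega>) (length p) < (v \<frown> \<zeta>) (length p)"
      using ab by (simp add: u v)
    show "(u \<frown> \<omega>) i = (v \<frown> \<zeta>) i" if "i < length p" for i
      using that by (simp add: u v nth_append)
  qed
qed

text \<open>Bijectivity of \<open>f\<close> turns the partition by \<open>U\<close> into a partition
  by the image words, and monotonicity keeps these in order, so listing \<open>U\<close>
  increasingly yields a diagram.\<close>

lemma tree_diagram_of_code:
  assumes n: "0 < n" and U: "complete_prefix_code n U"
    and f: "bij_betw f (cantor n) (cantor n)" "monotone_on (cantor n) less_fun less_fun f"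
    and g: "\<And>u \<omega>. u \<in> U \<Longrightarrow> \<omega> \<in> cantor n \<Longrightarrow> f (u \<frown> \<omega>) = g u \<frown> \<omega>"
  shows "\<exists>us. set us = U \<and> tree_diagram n f us (map g us)"
proof -
  define us where "us = sorted_list_of_set U"
  note U' = U[unfolded complete_prefix_code_iff[OF n]]
  let ?z = "\<lambda>_::nat. 0::nat"
  have z: "?z \<in> cantor n" by (rule const_in_cantor[OF n])
  have set_us: "set us = U" using U' by (simp add: us_def)
  have uz: "u \<frown> ?z \<in> cantor n" if "u \<in> U" for u
    using U' that z by (blast intro: conc_in_cantor)
  have fC: "f \<omega> \<in> cantor n" if "\<omega> \<in> cantor n" for \<omega>
    using f(1) that by (rule bij_betwE[rule_format])
  have g_words: "g u \<in> words n" if "u \<in> U" for u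
    using fC[OF uz[OF that]] g[OF that z] by (simp add: conc_in_cantor_iff)
  \<comment> \<open>A common point of two image cylinders has one preimage under \<open>f\<close>,
    which would lie in both domain cylinders.\<close>
  have g_unique: "u = u'"
    if u: "u \<in> U" "u' \<in> U" and *: "\<omega> \<in> cylinder n (g u)" "\<omega> \<in> cylinder n (g u')" for u u' \<omega>
  proof -
    from * obtain \<zeta> \<zeta>' where \<zeta>: "\<zeta> \<in> cantor n" "\<zeta>' \<in> cantor n"
      "\<omega> = g u \<frown> \<zeta>" "\<omega> = g u' \<frown> \<zeta>'" by (auto simp: in_cylinder_iff)
    then have "f (u \<frown> \<zeta>) = f (u' \<frown> \<zeta>')" using g u by simp
    moreover have "u \<frown> \<zeta> \<in> cantor n" "u' \<frown> \<zeta>' \<in> cantor n"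
      using u \<zeta> U' by (auto intro: conc_in_cantor)
    ultimately have "u \<frown> \<zeta> = u' \<frown> \<zeta>'" 
      using inj_onD[OF bij_betw_imp_inj_on[OF f(1)]] by metis
    moreover have "u \<frown> \<zeta> \<in> cylinder n u" "u' \<frown> \<zeta>' \<in> cylinder n u'"
      using \<zeta> by (auto simp: in_cylinder_iff)
    ultimately show ?thesis using complete_prefix_code_unique[OF n U u] by simp
  qed
  have gU: "complete_prefix_code n (g ` U)"
    unfolding complete_prefix_code_iff[OF n]
  proof (intro conjI ballI)
    show "finite (g ` U)" "g ` U \<subseteq> words n" using U' g_words by auto
    fix \<omega> assume "\<omega> \<in> cantor n"
    then obtain \<zeta> where \<zeta>: "\<zeta> \<in> cantor n" "f \<zeta> = \<omega>"
      using f(1) by (metis bij_betw_def imageE)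
    with U' obtain u where u: "u \<in> U" "\<zeta> \<in> cylinder n u" by blast
    then have "\<omega> \<in> cylinder n (g u)" using g \<zeta>(2) by (auto simp: in_cylinder_iff)
    then show "\<exists>!v. v \<in> g ` U \<and> \<omega> \<in> cylinder n v"
      using u(1) g_unique by blast
  qed
  \<comment> \<open>The order of the image words is read off from the points with zero tails. As the
    image code is prefix-free, the opposite order of words would reverse the strict inequality
    between these points.\<close>
  have mono: "(g u, g v) \<in> lexord less_than"
    if uv: "u \<in> U" "v \<in> U" "(u, v) \<in> lexord less_than" for u v
  proof -
    have "u \<noteq> v" using uv(3) lexord_irreflexive[of less_than u] by auto
    then have "\<not> Sublist.prefix u v" using U uv(1,2) by (auto simp: complete_prefix_code_def)
    from lexord_imp_less_fun[OF uv(3) this] have "less_fun (u \<frown> ?z) (v \<frown> ?z)" .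
    from monotone_onD[OF f(2), OF uz uz this]
    have less: "less_fun (g u \<frown> ?z) (g v \<frown> ?z)"
      using uv z by (simp add: g)
    have ne: "g u \<noteq> g v" using less by (auto simp: less_fun_irrefl)
    then have "\<not> Sublist.prefix (g v) (g u)"
      using gU uv(1,2) unfolding complete_prefix_code_def by (metis imageI)
    then have "(g v, g u) \<notin> lexord less_than"
      using lexord_imp_less_fun[of "g v" "g u"] less_fun_asym[OF less] by blast
    then show ?thesis using ne lexord_linear[of less_than "g u" "g v"] by (auto simp: linorder_less_linear)
  qed
  have sorted: "sorted_wrt (\<lambda>u v. (u, v) \<in> lexord less_than) us"
    using strict_sorted_list_of_set[of U] unfolding us_def list_less_def less_than_eq .
  have "sorted_wrt (\<lambda>u v. (u, v) \<in> lexord less_than) (map g us)"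
    unfolding sorted_wrt_map by (rule sorted_wrt_mono_rel[OF _ sorted]) (use mono set_us in blast)
  then have "tree_diagram n f us (map g us)"
    using U gU sorted set_us g unfolding tree_diagram_def by (auto simp del: sorted_wrt_map)
  with set_us show ?thesis by blast
qed

text \<open>An order-reversing \<open>\<psi>\<close> reverses twice. To avoid treating
  \<open>\<phi>\<close> separately, the values of \<open>f\<close> are written as
  \<open>\<psi> a\<close> and \<open>\<psi> b\<close>; strictness of \<open>\<psi>\<close> excludes
  \<open>a = b\<close> and \<open>b\<close> below \<open>a\<close>, and totality gives the
  rest.\<close>

lemma monotone_on_conjugate:
  fixes \<psi> \<phi> :: "(nat \<Rightarrow> nat) \<Rightarrow> nat \<Rightarrow> nat"
  assumes bij: "bij_betw \<psi> X Y" "\<And>x. x \<in> X \<Longrightarrow> \<phi> (\<psi> x) = x"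
    and mono: "monotone_on X less_fun less_fun \<psi> \<or> monotone_on X less_fun (\<lambda>v w. less_fun w v) \<psi>"
    and f: "f ` Y \<subseteq> Y" "monotone_on Y less_fun less_fun f"
  shows "monotone_on X less_fun less_fun (\<lambda>x. \<phi> (f (\<psi> x)))"
proof (rule monotone_onI)
  fix v w assume vw: "v \<in> X" "w \<in> X" "less_fun v w"
  have \<psi>: "\<psi> v \<in> Y" "\<psi> w \<in> Y" using bij(1) vw by (auto simp: bij_betw_def)
  then have "f (\<psi> v) \<in> \<psi> ` X" "f (\<psi> w) \<in> \<psi> ` X" using f(1) bij(1) by (auto simp: bij_betw_def)
  then obtain a b where ab: "a \<in> X" "b \<in> X" "f (\<psi> v) = \<psi> a" "f (\<psi> w) = \<psi> b" by blast
  have "\<not> less_fun b a \<and> a \<noteq> b"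
    using mono
  proof
    assume m: "monotone_on X less_fun less_fun \<psi>"
    have "less_fun (\<psi> a) (\<psi> b)"
      using monotone_onD[OF f(2), OF \<psi> monotone_onD[OF m, OF vw]] ab by simp
    then show ?thesis
      using monotone_onD[OF m, OF ab(2,1)] by (auto simp: less_fun_irrefl dest: less_fun_asym)
  next
    assume m: "monotone_on X less_fun (\<lambda>v w. less_fun w v) \<psi>"
    have "less_fun (\<psi> b) (\<psi> a)"
      using monotone_onD[OF f(2), OF \<psi>(2,1) monotone_onD[OF m, OF vw]] ab by simp
    then show ?thesis
      using monotone_onD[OF m, OF ab(2,1)] by (auto simp: less_fun_irrefl dest: less_fun_asym)
  qed
  then show "less_fun (\<phi> (f (\<psi> v))) (\<phi> (f (\<psi> w)))"
    using less_fun_total[of a b] ab bij(2) by simp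
qed


section \<open>Local actions\<close>

lemma restrict_local_action [simp]:
  "restrict (local_action m f x) (cantor m) = local_action m f x"
  by (simp add: local_action_def)

text \<open>A letter common to all values could be appended to \<open>theta m f x\<close>, against
  its maximality.\<close>

lemma local_action_no_common_letter:
  assumes "2 \<le> m" "inj_on f (cantor m)" "x \<in> words m"
  shows "\<exists>\<omega>\<in>cantor m. local_action m f x \<omega> 0 \<noteq> a"
proof (rule ccontr)
  assume "\<not> ?thesis"
  then have a: "local_action m f x \<omega> 0 = a" if "\<omega> \<in> cantor m" for \<omega> using that by blast
  have "\<forall>\<omega> \<in> f ` cylinder m x. \<omega> \<in> range (\<lambda>\<zeta>. (theta m f x @ [a]) \<frown> \<zeta>)"
  proof
    fix \<xi> assume "\<xi> \<in> f ` cylinder m x"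
    then obtain \<omega> where \<omega>: "\<omega> \<in> cantor m" "\<xi> = f (x \<frown> \<omega>)"
      by (auto simp: in_cylinder_iff)
    let ?g = "local_action m f x \<omega>"
    have "?g = [a] \<frown> Omega_Words_Fun.suffix 1 ?g"
      using a[OF \<omega>(1)] by (auto simp: fun_eq_iff conc_def)
    then have "f (x \<frown> \<omega>) = theta m f x \<frown> [a] \<frown> Omega_Words_Fun.suffix 1 ?g"
      using local_action_eq[OF assms \<omega>(1)] by metis
    then show "\<xi> \<in> range (\<lambda>\<zeta>. (theta m f x @ [a]) \<frown> \<zeta>)"
      using \<omega>(2) by simp
  qed
  then show False
    using common_prefix_theta(2)[OF assms, of "theta m f x @ [a]"] by simp
qed

text \<open>Any factorization with no common first letter left in \<open>g\<close> is the canonical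
  one: maximality gives \<open>theta m f x = p @ w\<close>, and a first letter of \<open>w\<close>
  would be common to all \<open>g \<omega>\<close>. All later computations of \<open>theta\<close>
  and \<open>local_action\<close> rest on this.\<close>

lemma theta_local_action_eqI:
  assumes "2 \<le> m" "inj_on f (cantor m)" "x \<in> words m"
    and g: "\<And>\<omega>. \<omega> \<in> cantor m \<Longrightarrow> f (x \<frown> \<omega>) = p \<frown> g \<omega>"
    and no_letter: "\<And>a. \<exists>\<omega>\<in>cantor m. g \<omega> 0 \<noteq> a"
  shows "theta m f x = p" "local_action m f x = restrict g (cantor m)"
proof -
  note f = local_action_eq[OF assms(1-3)]
  have "\<forall>\<omega> \<in> f ` cylinder m x. \<omega> \<in> range (\<lambda>\<zeta>. p \<frown> \<zeta>)"
    using g by (auto simp: in_cylinder_iff)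
  then have le: "length p \<le> length (theta m f x)"
    by (rule common_prefix_theta(2)[OF assms(1-3)])
  \<comment> \<open>A sample point, at which comparing the two factorizations makes \<open>p\<close>
    a prefix of \<open>theta m f x\<close>.\<close>
  have "(\<lambda>_. 0) \<in> cantor m" using assms(1) by (simp add: const_in_cantor)
  then have "p \<frown> g (\<lambda>_. 0) = theta m f x \<frown> local_action m f x (\<lambda>_. 0)"
    using f g by metis
  then obtain w where w: "theta m f x = p @ w"
    using le by (rule conc_eq_concE)
  have gw: "g \<omega> = w \<frown> local_action m f x \<omega>" if "\<omega> \<in> cantor m" for \<omega>
  proof -
    have "p \<frown> g \<omega> = p \<frown> w \<frown> local_action m f x \<omega>"
      using f[OF that] g[OF that] w by simp
    then show ?thesis by (simp only: conc_inject)
  qed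
  have "w = []"
  proof (cases w)
    case (Cons a w')
    with gw no_letter[of a] show ?thesis by auto
  qed
  with w show "theta m f x = p" by simp
  show "local_action m f x = restrict g (cantor m)"
    using gw \<open>w = []\<close> by (auto simp: fun_eq_iff local_action_def)
qed

lemma inj_local_action:
  assumes "2 \<le> m" "inj_on f (cantor m)" "x \<in> words m"
  shows "inj_on (local_action m f x) (cantor m)"
proof (rule inj_onI)
  fix \<omega> \<zeta> assume *: "\<omega> \<in> cantor m" "\<zeta> \<in> cantor m" "local_action m f x \<omega> = local_action m f x \<zeta>"
  then have "f (x \<frown> \<omega>) = f (x \<frown> \<zeta>)" using local_action_eq[OF assms] by metis
  then have "x \<frown> \<omega> = x \<frown> \<zeta>"
    using assms(2,3) *(1,2) by (meson conc_in_cantor inj_onD)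
  then show "\<omega> = \<zeta>" by simp
qed

text \<open>The cocycle rule that makes local actions the states of a transducer. Factoring first at
  \<open>x\<close> and then at \<open>y\<close> leaves no common letter, so it is the factorization
  at \<open>x @ y\<close>.\<close>

lemma theta_local_action_append:
  assumes "2 \<le> m" "inj_on f (cantor m)" "x \<in> words m" "y \<in> words m"
  shows "theta m f (x @ y) = theta m f x @ theta m (local_action m f x) y"
    and "local_action m f (x @ y) = local_action m (local_action m f x) y"
proof -
  let ?g = "local_action m f x"
  note g = inj_local_action[OF assms(1-3)]
  have xy: "x @ y \<in> words m" using assms by simp
  have eq: "f ((x @ y) \<frown> \<omega>) = (theta m f x @ theta m ?g y) \<frown> local_action m ?g y \<omega>"
    if "\<omega> \<in> cantor m" for \<omega>
    using local_action_eq[OF assms(1-3) conc_in_cantor[OF assms(4) that]]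
      local_action_eq[OF assms(1) g assms(4) that] by simp
  note * = theta_local_action_eqI[OF assms(1,2) xy eq local_action_no_common_letter[OF assms(1) g assms(4)]]
  show "theta m f (x @ y) = theta m f x @ theta m ?g y" by (rule *(1))
  show "local_action m f (x @ y) = local_action m ?g y"
    using *(2) by simp
qed

lemma theta_in_words:
  assumes "2 \<le> m" "inj_on f (cantor m)" "x \<in> words m" "f ` cantor m \<subseteq> cantor n"
  shows "theta m f x \<in> words n"
proof -
  have z: "(\<lambda>_. 0) \<in> cantor m" using assms(1) by (simp add: const_in_cantor)
  then have "f (x \<frown> (\<lambda>_. 0)) \<in> cantor n"
    using assms(3,4) conc_in_cantor by blast
  then show ?thesis
    using local_action_eq[OF assms(1-3) z] by (simp add: conc_in_cantor_iff)
qed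

lemma theta_local_action_Nil:
  assumes "2 \<le> m" "2 \<le> n" "bij_betw f (cantor m) (cantor n)"
  shows "theta m f [] = []" "local_action m f [] = restrict f (cantor m)"
proof -
  have inj: "inj_on f (cantor m)" using assms(3) by (simp add: bij_betw_def)
  have no_letter: "\<exists>\<omega>\<in>cantor m. f \<omega> 0 \<noteq> a" for a
  proof -
    \<comment> \<open>A constant sequence avoiding the letter \<open>a\<close>; surjectivity of
      \<open>f\<close> and \<open>2 \<le> n\<close> put it into the image.\<close>
    have "(\<lambda>_. if a = 0 then 1 else 0) \<in> f ` cantor m"
      using assms(2,3) by (simp add: bij_betw_def cantor_def)
    then obtain \<omega> where "\<omega> \<in> cantor m" "f \<omega> = (\<lambda>_. if a = 0 then 1 else 0)" by auto
    then show ?thesis by (intro bexI[of _ \<omega>]) auto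
  qed
  have "[] \<in> words m" by (simp add: words_def)
  note * = theta_local_action_eqI[OF assms(1) inj this, where p = "[]" and g = f, OF _ no_letter]
  show "theta m f [] = []" "local_action m f [] = restrict f (cantor m)"
    by (rule *, simp)+
qed


section \<open>Runs of automata\<close>

lemma run_append: "run A q (u @ v) = Option.bind (run A q u) (\<lambda>q'. run A q' v)"
  by (induction u arbitrary: q) (auto split: bind_split)

lemma (in full_tree_automaton) run_total:
  assumes "q \<in> states A" "u \<in> words n"
  obtains q' where "run A q u = Some q'" "q' \<in> states A"
  using assms
proof (induction u arbitrary: q thesis)
  case Nil
  then show ?case by simp
next
  case (Cons a u)
  then have a: "a < n" "u \<in> words n" by (auto simp: words_def)
  with full Cons.prems(2) obtain p where p: "trans A (q, a) = Some p" by blast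
  with ran_trans have "p \<in> states A" by (auto simp: ran_def)
  with Cons.IH[of p] a obtain q' where "run A p u = Some q'" "q' \<in> states A" by blast
  with p show ?case by (intro Cons.prems(1)) auto
qed

section \<open>Runs in the reachable part and in the pullback\<close>

lemma root_reachable_part [simp]: "root (reachable_part m B) = root B"
  by (simp add: reachable_part_def Let_def)

text \<open>A run starting at a reached state meets reached states only, so the restriction removes
  none of its transitions. The word \<open>u\<close> witnesses this and grows by one letter in each
  induction step.\<close>

lemma run_reachable_part:
  assumes "u \<in> words m" "v \<in> words m" "run B (root B) u = Some q"
  shows "run (reachable_part m B) q v = run B q v"
  using assms
proof (induction v arbitrary: u q)
  case (Cons a v)
  from Cons.prems have a: "a < m" "v \<in> words m" by (auto simp: words_def)
  have "q \<in> {p. \<exists>x\<in>words m. run B (root B) x = Some p}"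
    using Cons.prems by blast
  then have trans: "trans (reachable_part m B) (q, a) = trans B (q, a)"
    using a(1) by (simp add: reachable_part_def Let_def restrict_map_def)
  show ?case
  proof (cases "trans B (q, a)")
    case (Some p)
    have "u @ [a] \<in> words m" using Cons.prems(1) a(1) by (simp add: words_def)
    moreover have "run B (root B) (u @ [a]) = Some p"
      using Cons.prems(3) Some by (simp add: run_append)
    ultimately have "run (reachable_part m B) p v = run B p v"
      using Cons.IH a(2) by blast
    with trans Some show ?thesis by simp
  qed (simp add: trans)
qed simp

text \<open>Induction on the last letter with \<open>theta_local_action_append\<close>. Fullness of
  \<open>A\<close> keeps its component defined, so that the guard of the product transition holds at
  each step.\<close>

lemma run_pullback:
  assumes "2 \<le> n" "2 \<le> m" "bij_betw \<phi> (cantor m) (cantor n)" "full_tree_automaton n A" "x \<in> words m"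
  shows "run (pullback_automaton m \<phi> A) (root (pullback_automaton m \<phi> A)) x =
    map_option (Pair (local_action m \<phi> x)) (run A (root A) (theta m \<phi> x))"
proof -
  interpret full_tree_automaton n A by fact
  have inj: "inj_on \<phi> (cantor m)" and im: "\<phi> ` cantor m \<subseteq> cantor n"
    using assms(3) by (auto simp: bij_betw_def)
  let ?B = "product_automaton m (minimal_transducer m \<phi>) A"
  note \<phi>_Nil = theta_local_action_Nil[OF assms(2,1,3)]
  have "run ?B (root ?B) x = map_option (Pair (local_action m \<phi> x)) (run A (root A) (theta m \<phi> x))"
    using assms(5)
  proof (induction x rule: rev_induct)
    case Nil
    show ?case
      by (simp add: product_automaton_def minimal_transducer_def \<phi>_Nil restrict_def)
  next
    case (snoc a x)
    then have x: "x \<in> words m" and a: "a < m" "[a] \<in> words m" by (auto simp: words_def)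
    obtain q where q: "run A (root A) (theta m \<phi> x) = Some q" "q \<in> states A"
      using run_total[OF root_in_states theta_in_words[OF assms(2) inj x im]] .
    let ?s = "local_action m \<phi> x"
    have "trans ?B ((?s, q), a) = map_option (Pair (local_action m ?s [a])) (run A q (theta m ?s [a]))"
      using x a q(2) by (simp add: product_automaton_def minimal_transducer_def)
    then show ?case
      using snoc.IH[OF x] q(1)
      by (simp add: run_append theta_local_action_append[OF assms(2) inj x a(2)])
  qed
  moreover have "[] \<in> words m" by (simp add: words_def)
  ultimately show ?thesis
    using run_reachable_part[of "[]" m x ?B "root ?B"] assms(5)
    by (simp add: pullback_automaton_def)
qed


section \<open>The pullback theorem\<close>

lemma tree_diagram_actE:
  assumes "tree_diagram n f us vs" "u \<in> set us"
  obtains i where "i < length us" "u = us ! i" "\<And>\<omega>. \<omega> \<in> cantor n \<Longrightarrow> f (u \<frown> \<omega>) = vs ! i \<frown> \<omega>"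
proof -
  from assms(2) obtain i where i: "i < length us" "u = us ! i"
    by (auto simp: in_set_conv_nth)
  moreover have "f (u \<frown> \<omega>) = vs ! i \<frown> \<omega>" if "\<omega> \<in> cantor n" for \<omega>
    using assms(1) i that by (simp add: tree_diagram_def)
  ultimately show thesis by (rule that)
qed

text \<open>Reduces membership to prefix replacements at single words: the words of length
  \<open>K\<close> form a complete prefix code, and a choice of image words on it gives an accepted
  diagram.\<close>

lemma diagram_group_of_long_words:
  assumes n: "0 < n" and f: "f \<in> extensional (cantor n)" "homeomorphism (cantor n) (cantor n) f f'"
    "monotone_on (cantor n) less_fun less_fun f"
    and g: "\<And>u. u \<in> words n \<Longrightarrow> K \<le> length u \<Longrightarrow>
      \<exists>v. (\<forall>\<omega>\<in>cantor n. f (u \<frown> \<omega>) = v \<frown> \<omega>) \<and>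
        (\<exists>q. run A (root A) u = Some q \<and> run A (root A) v = Some q)"
  shows "f \<in> diagram_group n A"
proof -
  let ?U = "{u \<in> words n. length u = K}"
  have "\<forall>u\<in>?U. \<exists>v. (\<forall>\<omega>\<in>cantor n. f (u \<frown> \<omega>) = v \<frown> \<omega>) \<and>
        (\<exists>q. run A (root A) u = Some q \<and> run A (root A) v = Some q)"
    using g by simp
  from bchoice[OF this] obtain G where
    G: "\<And>u \<omega>. u \<in> ?U \<Longrightarrow> \<omega> \<in> cantor n \<Longrightarrow> f (u \<frown> \<omega>) = G u \<frown> \<omega>"
    and acc: "\<And>u. u \<in> ?U \<Longrightarrow> \<exists>q. run A (root A) u = Some q \<and> run A (root A) (G u) = Some q"
    by blast
  have "bij_betw f (cantor n) (cantor n)"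
    by (rule bij_betw_byWitness[where f' = f']) (use f(2) in \<open>auto simp: homeomorphism_def\<close>)
  from tree_diagram_of_code[OF n complete_prefix_code_length[OF n] this f(3) G]
  obtain us where us: "set us = ?U" "tree_diagram n f us (map G us)" by blast
  have "accepted A us (map G us)"
    unfolding accepted_def
  proof (intro allI impI)
    fix i assume "i < length us"
    moreover from this have "us ! i \<in> ?U" using us(1) nth_mem by blast
    ultimately show "\<exists>q. run A (root A) (us ! i) = Some q \<and> run A (root A) (map G us ! i) = Some q"
      using acc by simp
  qed
  moreover have "f \<in> thompson_F n"
    using f us(2) unfolding thompson_F_def by blast
  ultimately show ?thesis
    using us(2) unfolding diagram_group_def by blast
qed

theorem theorem5p3:
  fixes n m :: nat
    and \<psi> \<phi> :: "(nat \<Rightarrow> nat) \<Rightarrow> nat \<Rightarrow> nat"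
    and A :: "'q automaton"
    and H :: "((nat \<Rightarrow> nat) \<Rightarrow> nat \<Rightarrow> nat) set"
  assumes "2 \<le> n" and "2 \<le> m"
    and "homeomorphism (cantor n) (cantor m) \<psi> \<phi>"
    and "monotone_on (cantor n) less_fun less_fun \<psi> \<or>
         monotone_on (cantor n) less_fun (\<lambda>v w. less_fun w v) \<psi>"
    and "full_tree_automaton n A"
    and "H = diagram_group n A"
  shows "diagram_group m (pullback_automaton m \<phi> A) = conjugate m \<psi> \<phi> H \<inter> thompson_F m"
proof -
  interpret full_tree_automaton n A by fact
  let ?P = "pullback_automaton m \<phi> A"
  have n: "0 < n" and m: "0 < m" using assms(1,2) by auto
  note hom = assms(3)
  have \<phi>\<psi>: "\<And>\<omega>. \<omega> \<in> cantor n \<Longrightarrow> \<phi> (\<psi> \<omega>) = \<omega>"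
    and \<psi>\<phi>: "\<And>\<omega>. \<omega> \<in> cantor m \<Longrightarrow> \<psi> (\<phi> \<omega>) = \<omega>"
    and \<psi>_im: "\<psi> ` cantor n = cantor m" and \<phi>_im: "\<phi> ` cantor m = cantor n"
    and cont: "continuous_on (cantor n) \<psi>" "continuous_on (cantor m) \<phi>"
    using hom by (auto simp: homeomorphism_def)
  have \<psi>C: "\<psi> \<omega> \<in> cantor m" if "\<omega> \<in> cantor n" for \<omega> using that \<psi>_im by blast
  have \<phi>C: "\<phi> \<omega> \<in> cantor n" if "\<omega> \<in> cantor m" for \<omega> using that \<phi>_im by blast
  have inj: "inj_on \<phi> (cantor m)" using \<psi>\<phi> by (metis inj_onI)
  have inj\<psi>: "inj_on \<psi> (cantor n)" using \<phi>\<psi> by (metis inj_onI)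
  have bij: "bij_betw \<phi> (cantor m) (cantor n)" "bij_betw \<psi> (cantor n) (cantor m)"
    using inj inj\<psi> \<phi>_im \<psi>_im by (auto simp: bij_betw_def)
  note \<phi>_eq = local_action_eq[OF assms(2) inj]
  note run_P = run_pullback[OF assms(1,2) bij(1) assms(5)]
  have \<theta>_words: "theta m \<phi> x \<in> words n" if "x \<in> words m" for x
    using theta_in_words[OF assms(2) inj that] \<phi>_im by simp
  show ?thesis
  proof (intro equalityI subsetI)
    \<comment> \<open>First inclusion: an accepted diagram of \<open>f\<close> over the pullback
      yields one over \<open>A\<close> for the conjugate \<open>h\<close> of \<open>f\<close> by
      \<open>\<phi>\<close>.\<close>
    fix f assume f: "f \<in> diagram_group m ?P"
    then have fF: "f \<in> thompson_F m" by (simp add: diagram_group_def)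
    from f obtain us vs where diag: "tree_diagram m f us vs" and acc: "accepted ?P us vs"
      unfolding diagram_group_def by blast
    from fF obtain f' where f': "homeomorphism (cantor m) (cantor m) f f'"
      and f_ext: "f \<in> extensional (cantor m)"
      and f_mono: "monotone_on (cantor m) less_fun less_fun f"
      unfolding thompson_F_def by blast
    have f_im: "f ` cantor m \<subseteq> cantor m" using f' by (simp add: homeomorphism_def)
    define h where "h = restrict (\<lambda>\<omega>. \<phi> (f (\<psi> \<omega>))) (cantor n)"
    have "homeomorphism (cantor n) (cantor n) (\<phi> \<circ> (f \<circ> \<psi>)) ((\<phi> \<circ> f') \<circ> \<psi>)"
      by (rule homeomorphism_compose[OF homeomorphism_compose[OF hom f'] homeomorphism_symD[OF hom]])
    then have h_hom: "homeomorphism (cantor n) (cantor n) h ((\<phi> \<circ> f') \<circ> \<psi>)"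
      by (rule homeomorphism_cong) (auto simp: h_def)
    have h_mono: "monotone_on (cantor n) less_fun less_fun h"
      using monotone_on_conjugate[OF bij(2) \<phi>\<psi> assms(4) f_im f_mono]
      by (simp add: h_def monotone_on_def)
    have us: "complete_prefix_code m (set us)" "complete_prefix_code m (set vs)" "length us = length vs"
      using diag by (auto simp: tree_diagram_def)
    \<comment> \<open>For long \<open>w\<close>, the cylinder of \<open>w\<close> lies inside the
      image under \<open>\<phi>\<close> of the cylinder of one branch word \<open>x\<close>.\<close>
    obtain K where K: "\<And>w. w \<in> words n \<Longrightarrow> K \<le> length w \<Longrightarrow> \<exists>x\<in>set us. \<psi> ` cylinder n w \<subseteq> cylinder m x"
      by (rule uniform_refinement[OF m cont(1) _ us(1)]) (use \<psi>_im in auto)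
    have "h \<in> diagram_group n A"
    proof (rule diagram_group_of_long_words[OF n _ h_hom h_mono])
      show "h \<in> extensional (cantor n)" by (simp add: h_def)
      fix w assume w: "w \<in> words n" "K \<le> length w"
      obtain x where x: "x \<in> set us" "\<psi> ` cylinder n w \<subseteq> cylinder m x" using K[OF w] by blast
      from x(1) obtain i where i: "i < length us" "x = us ! i"
        and fx: "\<And>\<omega>. \<omega> \<in> cantor m \<Longrightarrow> f (x \<frown> \<omega>) = vs ! i \<frown> \<omega>"
        using tree_diagram_actE[OF diag] by blast
      define y where "y = vs ! i"
      have xm: "x \<in> words m" and ym: "y \<in> words m"
        using us i unfolding y_def complete_prefix_code_def by (auto simp: subset_iff)
      from acc i obtain p where "run ?P (root ?P) x = Some p" "run ?P (root ?P) y = Some p"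
        unfolding accepted_def y_def by blast
      \<comment> \<open>Equality of the pullback states splits into equal local actions and equal
        states of \<open>A\<close>.\<close>
      then obtain q where act: "local_action m \<phi> x = local_action m \<phi> y"
        and q: "run A (root A) (theta m \<phi> x) = Some q" "run A (root A) (theta m \<phi> y) = Some q"
        by (auto simp: run_P xm ym)
      have w_pre: "\<exists>\<zeta>\<in>cantor m. \<psi> (w \<frown> \<omega>) = x \<frown> \<zeta> \<and> w \<frown> \<omega> = theta m \<phi> x \<frown> local_action m \<phi> x \<zeta>"
        if \<omega>: "\<omega> \<in> cantor n" for \<omega>
      proof -
        have w\<omega>: "w \<frown> \<omega> \<in> cylinder n w" "w \<frown> \<omega> \<in> cantor n"
          using \<omega> conc_in_cantor[OF w(1)] by (auto simp: in_cylinder_iff)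
        with x(2) have "\<psi> (w \<frown> \<omega>) \<in> cylinder m x" by blast
        then obtain \<zeta> where \<zeta>: "\<zeta> \<in> cantor m" "\<psi> (w \<frown> \<omega>) = x \<frown> \<zeta>"
          by (auto simp: in_cylinder_iff)
        then have "w \<frown> \<omega> = \<phi> (x \<frown> \<zeta>)" using \<phi>\<psi>[OF w\<omega>(2)] by simp
        with \<zeta> \<phi>_eq[OF xm \<zeta>(1)] show ?thesis by metis
      qed
      have "local_action m \<phi> x \<zeta> \<in> cantor n" if "\<zeta> \<in> cantor m" for \<zeta>
        using \<phi>C[OF conc_in_cantor[OF xm that]] \<phi>_eq[OF xm that] by (simp add: conc_in_cantor_iff)
      then have "w \<frown> \<omega> \<in> cylinder n (theta m \<phi> x)" if "\<omega> \<in> cantor n" for \<omega>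
        using w_pre[OF that] unfolding in_cylinder_iff by blast
      then have "cylinder n w \<subseteq> cylinder n (theta m \<phi> x)"
        by (auto simp: cylinder_def[of n w])
      \<comment> \<open>All points of the cylinder of \<open>w\<close> are values of
        \<open>\<phi>\<close> on that of \<open>x\<close>, hence begin with
        \<open>theta m \<phi> x\<close>.\<close>
      then obtain t where t: "w = theta m \<phi> x @ t"
        by (rule cylinder_subset_imp_prefix[OF assms(1)])
      \<comment> \<open>Here \<open>t \<frown> \<omega>\<close> is the value at
        \<open>\<zeta>\<close> of the local action at \<open>x\<close>, which is also the one at
        \<open>y\<close>; replacing \<open>x\<close> by \<open>y\<close> therefore changes only the
        \<open>theta\<close> part.\<close>
      have "h (w \<frown> \<omega>) = (theta m \<phi> y @ t) \<frown> \<omega>" if \<omega>: "\<omega> \<in> cantor n" for \<omega>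
      proof -
        obtain \<zeta> where \<zeta>: "\<zeta> \<in> cantor m" "\<psi> (w \<frown> \<omega>) = x \<frown> \<zeta>"
          "w \<frown> \<omega> = theta m \<phi> x \<frown> local_action m \<phi> x \<zeta>" using w_pre[OF \<omega>] by blast
        have "theta m \<phi> x \<frown> (t \<frown> \<omega>) = theta m \<phi> x \<frown> local_action m \<phi> x \<zeta>"
          using \<zeta>(3) t by simp
        then have t\<omega>: "t \<frown> \<omega> = local_action m \<phi> x \<zeta>" by (simp only: conc_inject)
        have "h (w \<frown> \<omega>) = \<phi> (y \<frown> \<zeta>)"
          using \<zeta>(1,2) fx conc_in_cantor[OF w(1) \<omega>] by (simp add: h_def y_def)
        also have "\<dots> = theta m \<phi> y \<frown> t \<frown> \<omega>"
          using \<phi>_eq[OF ym \<zeta>(1)] act t\<omega> by simp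
        finally show ?thesis by simp
      qed
      \<comment> \<open>Both runs pass through the same state and then read the same word
        \<open>t\<close>; totality makes the result defined.\<close>
      moreover have "\<exists>q. run A (root A) w = Some q \<and> run A (root A) (theta m \<phi> y @ t) = Some q"
      proof -
        have "run A (root A) (theta m \<phi> y @ t) = run A (root A) w"
          using q by (simp add: t run_append)
        then show ?thesis
          using run_total[OF root_in_states w(1)] by metis
      qed
      ultimately show "\<exists>v. (\<forall>\<omega>\<in>cantor n. h (w \<frown> \<omega>) = v \<frown> \<omega>) \<and>
          (\<exists>q. run A (root A) w = Some q \<and> run A (root A) v = Some q)" by blast
    qed
    moreover have "f = (\<lambda>\<omega>\<in>cantor m. \<psi> (h (\<phi> \<omega>)))"
    proof (rule extensionalityI[OF f_ext])
      fix \<omega> assume "\<omega> \<in> cantor m"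
      then show "f \<omega> = (\<lambda>\<omega>\<in>cantor m. \<psi> (h (\<phi> \<omega>))) \<omega>"
        using f_im by (simp add: h_def \<phi>C \<psi>\<phi> image_subset_iff)
    qed simp
    ultimately show "f \<in> conjugate m \<psi> \<phi> H \<inter> thompson_F m"
      using fF unfolding assms(6) conjugate_def by blast
  next
    \<comment> \<open>Second inclusion: membership in \<open>thompson_F m\<close> gives prefix
      replacements \<open>x \<rightarrow> y\<close> for \<open>f\<close>, and the accepted diagram
      of \<open>h\<close> gives \<open>u \<rightarrow> v\<close>. Both are needed to compare the
      pullback states of \<open>x\<close> and \<open>y\<close>.\<close>
    fix f assume "f \<in> conjugate m \<psi> \<phi> H \<inter> thompson_F m"
    then obtain h where hH: "h \<in> diagram_group n A"
      and f_eq: "f = (\<lambda>\<omega>\<in>cantor m. \<psi> (h (\<phi> \<omega>)))" and fF: "f \<in> thompson_F m"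
      unfolding assms(6) conjugate_def by blast
    from fF obtain f' xs ys where f': "homeomorphism (cantor m) (cantor m) f f'"
      and f_ext: "f \<in> extensional (cantor m)"
      and f_mono: "monotone_on (cantor m) less_fun less_fun f"
      and xy: "tree_diagram m f xs ys"
      unfolding thompson_F_def by blast
    from hH obtain us vs where diag: "tree_diagram n h us vs" and acc: "accepted A us vs"
      and hF: "h \<in> thompson_F n"
      unfolding diagram_group_def by blast
    have hC: "h \<omega> \<in> cantor n" if "\<omega> \<in> cantor n" for \<omega>
      using hF that unfolding thompson_F_def homeomorphism_def by blast
    have xs: "complete_prefix_code m (set xs)" "complete_prefix_code m (set ys)" "length xs = length ys"
      using xy by (auto simp: tree_diagram_def)
    have us: "complete_prefix_code n (set us)" using diag by (auto simp: tree_diagram_def)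
    obtain K where K: "\<And>w. w \<in> words m \<Longrightarrow> K \<le> length w \<Longrightarrow> \<exists>u\<in>set us. \<phi> ` cylinder m w \<subseteq> cylinder n u"
      by (rule uniform_refinement[OF n cont(2) _ us]) (use \<phi>_im in auto)
    \<comment> \<open>Refinement along the identity: words of length at least \<open>L\<close>
      extend a branch word of \<open>f\<close>, while \<open>K\<close> places their image under
      \<open>\<phi>\<close> in one branch cylinder of \<open>h\<close>.\<close>
    obtain L where L: "\<And>w. w \<in> words m \<Longrightarrow> L \<le> length w \<Longrightarrow> \<exists>x\<in>set xs. id ` cylinder m w \<subseteq> cylinder m x"
      by (rule uniform_refinement[OF m continuous_on_id' _ xs(1)]) auto
    show "f \<in> diagram_group m ?P"
    proof (rule diagram_group_of_long_words[OF m f_ext f' f_mono, where K = "max K L"])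
      fix x assume x: "x \<in> words m" "max K L \<le> length x"
      obtain x0 where x0: "x0 \<in> set xs" "cylinder m x \<subseteq> cylinder m x0"
        using L[OF x(1)] x(2) by auto
      obtain u where u: "u \<in> set us" "\<phi> ` cylinder m x \<subseteq> cylinder n u"
        using K[OF x(1)] x(2) by auto
      from x0(1) obtain i where i: "i < length xs" "x0 = xs ! i"
        and f_x0: "\<And>\<omega>. \<omega> \<in> cantor m \<Longrightarrow> f (x0 \<frown> \<omega>) = ys ! i \<frown> \<omega>"
        using tree_diagram_actE[OF xy] by blast
      from u(1) obtain j where j: "j < length us" "u = us ! j"
        and h_u: "\<And>\<omega>. \<omega> \<in> cantor n \<Longrightarrow> h (u \<frown> \<omega>) = vs ! j \<frown> \<omega>"
        using tree_diagram_actE[OF diag] by blast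
      define v where "v = vs ! j"
      obtain t where t: "x = x0 @ t"
        by (rule cylinder_subset_imp_prefix[OF assms(2) x0(2)])
      define y where "y = ys ! i @ t"
      have tm: "t \<in> words m" using x(1) t by simp
      have "ys ! i \<in> words m"
        using xs i unfolding complete_prefix_code_def by (auto simp: subset_iff)
      then have ym: "y \<in> words m" using tm by (simp add: y_def)
      have fx: "f (x \<frown> \<omega>) = y \<frown> \<omega>" if "\<omega> \<in> cantor m" for \<omega>
        using f_x0[OF conc_in_cantor[OF tm that]] by (simp add: t y_def)
      have in_u: "\<exists>\<zeta>\<in>cantor n. theta m \<phi> x \<frown> local_action m \<phi> x \<omega> = u \<frown> \<zeta>"
        if "\<omega> \<in> cantor m" for \<omega>
      proof -
        have "x \<frown> \<omega> \<in> cylinder m x" using that by (auto simp: in_cylinder_iff)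
        with u(2) have "\<phi> (x \<frown> \<omega>) \<in> cylinder n u" by blast
        then show ?thesis using \<phi>_eq[OF x(1) that] by (auto simp: in_cylinder_iff)
      qed
      \<comment> \<open>\<open>u\<close> is a common prefix of the image of the cylinder of
        \<open>x\<close>, so the maximal one is at least as long, and hence extends
        \<open>u\<close>.\<close>
      have "length u \<le> length (theta m \<phi> x)"
      proof (rule common_prefix_theta(2)[OF assms(2) inj x(1)])
        show "\<forall>\<omega>\<in>\<phi> ` cylinder m x. \<omega> \<in> range (\<lambda>\<zeta>. u \<frown> \<zeta>)"
          using u(2) by (auto simp: cylinder_def)
      qed
      moreover obtain \<zeta>0 where "u \<frown> \<zeta>0 = theta m \<phi> x \<frown> local_action m \<phi> x (\<lambda>_. 0)"
        using in_u[OF const_in_cantor[OF m]] by metis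
      ultimately obtain w where w: "theta m \<phi> x = u @ w"
        using conc_eq_concE by metis
      \<comment> \<open>Apply \<open>\<phi>\<close> to \<open>f = \<psi> h \<phi>\<close> at
        \<open>x \<frown> \<omega>\<close>: then \<open>h\<close> replaces \<open>u\<close> by
        \<open>v\<close> and leaves \<open>w\<close> and the tail alone.\<close>
      have \<phi>y: "\<phi> (y \<frown> \<omega>) = (v @ w) \<frown> local_action m \<phi> x \<omega>" if \<omega>: "\<omega> \<in> cantor m" for \<omega>
      proof -
        obtain \<zeta> where \<zeta>: "\<zeta> \<in> cantor n" "theta m \<phi> x \<frown> local_action m \<phi> x \<omega> = u \<frown> \<zeta>"
          using in_u[OF \<omega>] by blast
        then have "u \<frown> (w \<frown> local_action m \<phi> x \<omega>) = u \<frown> \<zeta>" by (simp add: w)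
        then have \<zeta>': "\<zeta> = w \<frown> local_action m \<phi> x \<omega>" by (simp only: conc_inject)
        have x\<omega>: "x \<frown> \<omega> \<in> cantor m" by (rule conc_in_cantor[OF x(1) \<omega>])
        have "y \<frown> \<omega> = \<psi> (h (\<phi> (x \<frown> \<omega>)))" using fx[OF \<omega>] x\<omega> by (simp add: f_eq)
        then have "\<phi> (y \<frown> \<omega>) = h (\<phi> (x \<frown> \<omega>))" using \<phi>\<psi> hC \<phi>C x\<omega> by simp
        also have "\<dots> = v \<frown> \<zeta>" using \<phi>_eq[OF x(1) \<omega>] \<zeta> h_u by (simp add: v_def)
        finally show ?thesis by (simp add: \<zeta>')
      qed
      \<comment> \<open>The local action at \<open>x\<close> has no common first letter, so this
        factorization is canonical for \<open>y\<close>: \<open>theta m \<phi> y = v @ w\<close>,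
        with the same local action as \<open>x\<close>.\<close>
      note y = theta_local_action_eqI[OF assms(2) inj ym \<phi>y
          local_action_no_common_letter[OF assms(2) inj x(1)]]
      obtain q where "run A (root A) u = Some q" "run A (root A) v = Some q"
        using acc j unfolding accepted_def v_def by blast
      \<comment> \<open>Acceptance brings \<open>u\<close> and \<open>v\<close> to one state, from
        which \<open>w\<close> is read in both runs.\<close>
      then have "run A (root A) (theta m \<phi> y) = run A (root A) (theta m \<phi> x)"
        by (simp add: y(1) w run_append)
      then have "run ?P (root ?P) y = run ?P (root ?P) x"
        using y(2) by (simp add: run_P x(1) ym)
      moreover obtain q where "run ?P (root ?P) x = Some q"
        using run_total[OF root_in_states \<theta>_words[OF x(1)]] by (metis run_P[OF x(1)] option.map(2))
      ultimately show "\<exists>v. (\<forall>\<omega>\<in>cantor m. f (x \<frown> \<omega>) = v \<frown> \<omega>) \<and>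
          (\<exists>q. run ?P (root ?P) x = Some q \<and> run ?P (root ?P) v = Some q)"
        using fx by metis
    qed
  qed
qed

end
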